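(* Let $T:X\to X$ be an invertible ergodic measure-preserving transformation on a probability space $(X,\mu)$. Suppose that $X$ is covered by a collection $\mathcal W^s$ of disjoint measurable subsets (called local stable leaves) such that $TW^s(x)\subseteq W^s(Tx)$ for all $x\in X$, where $W^s(x)$ denotes the partition element containing $x$, and let $\mathcal F_0$ denote the $\sigma$-algebra generated by $\mathcal W^s$. Let $\phi\in L^\infty(X)$ be a mean zero observable, $\int_X\phi\,d\mu=0$. Assume that there exist $\beta>1$ and $C>0$ such that for all $n\ge1$: (a) $\left|\int_X\phi\;\psi\circ T^n\,d\mu\right|\le C|\psi|_\infty n^{-\beta}$ for all $\psi\in L^\infty(\mathcal F_0)$; (b) $\int_X\operatorname{diam}\big(\phi(T^nW^s)\big)\,d\mu\le Cn^{-\beta}$, where the integrand at $x\in X$ is $\operatorname{diam}(\phi(T^nW^s(x)))$. Then for all $1\le p<\beta$, $$\sum_{n\ge1}\big|\mathbb E[\phi\circ T^{-n}|\mathcal F_0]\big|_p<\infty\quad\text{and}\quad\sum_{n\ge0}\big|\mathbb E[\phi\circ T^n|\mathcal F_0]-\phi\circ T^n\big|_p<\infty,$$ and for all $1\le p<2\beta$, $$\sum_{n\ge1}n^{-1/2}\big|\mathbb E[\phi\circ T^{-n}|\mathcal F_0]\big|_p<\infty\quad\text{and}\quad\sum_{n\ge1}n^{-1/2}\big|\mathbb E[\phi\circ T^n|\mathcal F_0]-\phi\circ T^n\big|_p<\infty.$$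
   Context: $|\cdot|_p$ is the norm of $L^p(X,\mu)$. $L^\infty(\mathcal F_0)$ is the set of functions in $L^\infty(X)$ that are $\mathcal F_0$-measurable. $\operatorname{diam}$ is the diameter of a subset of $\mathbb R$. Each set $T^{-1}W^s(x)$ is a union of elements of $\mathcal W^s$, and the paper notes that $T^{-1}\mathcal F_0\subseteq\mathcal F_0$.
   Formalization: It is additionally assumed that, for each n≥1, the supremum and infimum of φ∘T^n over W^s(x) are measurable in x (without this the claim can fail on general probability spaces); F_0 is read as the σ-algebra of measurable sets that are unions of leaves. *)

theory Defs
  imports "HOL-Probability.Probability"
begin

definition invertible_measure_preserving :: "'a measure \<Rightarrow> ('a \<Rightarrow> 'a) \<Rightarrow> bool" where
  "invertible_measure_preserving M T \<longleftrightarrow>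
     bij_betw T (space M) (space M) \<and> T \<in> M \<rightarrow>\<^sub>M M \<and>
     the_inv_into (space M) T \<in> M \<rightarrow>\<^sub>M M \<and>
     (\<forall>A\<in>sets M. emeasure M (T -` A \<inter> space M) = emeasure M A)"

definition ergodic :: "'a measure \<Rightarrow> ('a \<Rightarrow> 'a) \<Rightarrow> bool" where
  "ergodic M T \<longleftrightarrow>
     (\<forall>A\<in>sets M. T -` A \<inter> space M = A \<longrightarrow> measure M A = 0 \<or> measure M A = 1)"

definition leaf :: "'a set set \<Rightarrow> 'a \<Rightarrow> 'a set" where
  "leaf W x = (THE w. w \<in> W \<and> x \<in> w)"

text \<open>
  The sigma-algebra attached to a partition \<open>W\<close> consists of the measurable sets that are unions of
  elements of \<open>W\<close>, as is usual for (possibly uncountable) partitions.  The smallest sigma-algebra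
  containing the elements of \<open>W\<close> would be the wrong object: it contains only countable unions of
  leaves and their complements, so it is trivial modulo null sets when all leaves are null sets.
\<close>

definition leaf_algebra :: "'a measure \<Rightarrow> 'a set set \<Rightarrow> 'a measure" where
  "leaf_algebra M W = sigma (space M) {A \<in> sets M. \<exists>V\<subseteq>W. A = \<Union>V}"

lemma space_leaf_algebra [simp]: "space (leaf_algebra M W) = space M"
  unfolding leaf_algebra_def by (rule space_measure_of) (auto dest: sets.sets_into_space)

lemma sets_leaf_algebra:
  assumes "partition_on (space M) W"
  shows "sets (leaf_algebra M W) = {A \<in> sets M. \<exists>V\<subseteq>W. A = \<Union>V}"
proof -
  let ?S = "{A \<in> sets M. \<exists>V\<subseteq>W. A = \<Union>V}"
  have S: "?S = {A \<in> sets M. \<forall>w\<in>W. w \<inter> A \<noteq> {} \<longrightarrow> w \<subseteq> A}"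
  proof (intro Collect_cong conj_cong refl iffI ballI impI)
    fix A w assume "\<exists>V\<subseteq>W. A = \<Union>V" "w \<in> W" "w \<inter> A \<noteq> {}"
    then show "w \<subseteq> A"
      using partition_onD2[OF assms] unfolding disjoint_def by blast
  next
    fix A assume A: "A \<in> sets M" "\<forall>w\<in>W. w \<inter> A \<noteq> {} \<longrightarrow> w \<subseteq> A"
    then have "A \<subseteq> \<Union>W"
      using sets.sets_into_space partition_onD1[OF assms] by blast
    with A(2) have "A = \<Union>{w \<in> W. w \<inter> A \<noteq> {}}" by blast
    then show "\<exists>V\<subseteq>W. A = \<Union>V" by (intro exI[of _ "{w \<in> W. w \<inter> A \<noteq> {}}"]) auto
  qed
  have "sigma_algebra (space M) ?S"
    unfolding sigma_algebra_iff2
  proof (intro conjI ballI allI impI)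
    show "?S \<subseteq> Pow (space M)" by (auto dest: sets.sets_into_space)
    show "{} \<in> ?S" by auto
  next
    fix A assume "A \<in> ?S"
    moreover have "w \<subseteq> space M" if "w \<in> W" for w
      using that partition_onD1[OF assms] by blast
    ultimately show "space M - A \<in> ?S" unfolding S by blast
  next
    fix A :: "nat \<Rightarrow> 'a set" assume "range A \<subseteq> ?S"
    then show "\<Union>(range A) \<in> ?S" unfolding S by blast
  qed
  then show ?thesis
    unfolding leaf_algebra_def by (simp add: sigma_algebra.sets_measure_of_eq)
qed

lemma subalgebra_leaf_algebra:
  "partition_on (space M) W \<Longrightarrow> subalgebra M (leaf_algebra M W)"
  by (auto simp: subalgebra_def sets_leaf_algebra)

definition Linf_norm :: "'a measure \<Rightarrow> ('a \<Rightarrow> real) \<Rightarrow> ennreal" where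
  "Linf_norm M f = esssup M (\<lambda>x. ennreal \<bar>f x\<bar>)"

definition Linf :: "'a measure \<Rightarrow> ('a \<Rightarrow> real) set" where
  "Linf M = {f \<in> borel_measurable M. Linf_norm M f < \<infinity>}"

text \<open>
  Norms and diameters take values in \<^typ>\<open>ennreal\<close>.  In particular a function that is not in
  \<open>L\<^sup>p\<close> has norm \<open>\<infinity>\<close>, and an unbounded set has diameter \<open>\<infinity>\<close> (the library's
  \<^const>\<open>diameter\<close> is meaningful for bounded sets only); elements of \<^const>\<open>Linf\<close> may be unbounded
  on a null set that meets every leaf.
\<close>

definition Lp_norm :: "'a measure \<Rightarrow> real \<Rightarrow> ('a \<Rightarrow> real) \<Rightarrow> ennreal" where
  "Lp_norm M p f =
     (let I = (\<integral>\<^sup>+x. ennreal (\<bar>f x\<bar> powr p) \<partial>M)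
      in if I = \<infinity> then \<infinity> else ennreal (enn2real I powr (1 / p)))"

definition ediam :: "real set \<Rightarrow> ennreal" where
  "ediam S = (SUP s\<in>S. SUP t\<in>S. ennreal (dist s t))"

lemma ediam_eq_diameter:
  assumes "bounded S"
  shows "ediam S = ennreal (diameter S)"
proof (cases "S = {}")
  case True
  then show ?thesis by (simp add: ediam_def bot_ennreal)
next
  case False
  let ?d = "\<lambda>z::real \<times> real. dist (fst z) (snd z)"
  have le: "ennreal (?d z) \<le> ennreal (diameter S)" if "z \<in> S \<times> S" for z
    using diameter_bounded_bound[OF assms, of "fst z" "snd z"] that
    by (intro ennreal_leI) auto
  have "ediam S = (SUP z\<in>S \<times> S. ennreal (?d z))"
  proof (rule antisym)
    show "ediam S \<le> (SUP z\<in>S \<times> S. ennreal (?d z))"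
      unfolding ediam_def
    proof (intro SUP_least)
      fix s t assume "s \<in> S" "t \<in> S"
      then show "ennreal (dist s t) \<le> (SUP z\<in>S \<times> S. ennreal (?d z))"
        by (intro SUP_upper2[of "(s, t)"]) simp_all
    qed
    show "(SUP z\<in>S \<times> S. ennreal (?d z)) \<le> ediam S"
      unfolding ediam_def
    proof (rule SUP_least)
      fix z assume "z \<in> S \<times> S"
      then have "fst z \<in> S" "snd z \<in> S" by auto
      then show "ennreal (?d z) \<le> (SUP s\<in>S. SUP t\<in>S. ennreal (dist s t))"
        by (intro SUP_upper2[of "fst z" S] SUP_upper2[of "snd z" S]) simp_all
    qed
  qed
  also have "\<dots> = ennreal (SUP z\<in>S \<times> S. ?d z)"
  proof (rule ennreal_SUP[symmetric])
    have "(SUP z\<in>S \<times> S. ennreal (?d z)) \<le> ennreal (diameter S)"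
      using le by (rule SUP_least)
    then show "(SUP z\<in>S \<times> S. ennreal (?d z)) \<noteq> top"
      by (metis ennreal_neq_top neq_top_trans)
  qed (use False in auto)
  finally show ?thesis using False by (simp add: diameter_def case_prod_unfold)
qed

text \<open>
  Joint measurability of a function and a partition: the leafwise supremum and infimum are
  measurable.  Their difference is the leafwise diameter, so this is the measurability behind an
  integral of leafwise diameters.  It holds automatically, up to completion, for a Borel function
  and a measurable (countably separated) partition of a standard Borel space.  Some such condition
  is needed on an arbitrary probability space: measurability of the diameter alone does not force
  the conditional expectation given \<^const>\<open>leaf_algebra\<close> to lie between the leafwise infimum
  and supremum.
\<close>

definition leafwise_measurable :: "'a measure \<Rightarrow> 'a set set \<Rightarrow> ('a \<Rightarrow> real) \<Rightarrow> bool" where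
  "leafwise_measurable M W f \<longleftrightarrow>
     (\<lambda>x. SUP y\<in>leaf W x. ereal (f y)) \<in> borel_measurable M \<and>
     (\<lambda>x. INF y\<in>leaf W x. ereal (f y)) \<in> borel_measurable M"

end

theory Submission
  imports Defs
begin

text \<open>
  By duality \<open>\<bar>E[\<phi> \<circ> T\<^sup>-\<^sup>n | F\<^sub>0]\<bar>\<^sub>1 = \<integral> \<phi> \<cdot> (\<psi> \<circ> T\<^sup>n)\<close> with \<open>\<psi>\<close> the sign of the conditional expectation, so (a)
  bounds this norm by \<open>C n powr -\<beta>\<close>.  The leafwise infimum and supremum of \<open>\<phi> \<circ> T\<^sup>n\<close> are
  \<open>F\<^sub>0\<close>-measurable, so they enclose \<open>E[\<phi> \<circ> T\<^sup>n | F\<^sub>0]\<close> as well as \<open>\<phi> \<circ> T\<^sup>n\<close>, and (b) bounds the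
  \<open>L\<^sup>1\<close> norm of the difference.  Both families are uniformly bounded, so interpolating between
  \<open>L\<^sup>1\<close> and \<open>L\<^sup>\<infinity>\<close> bounds the \<open>L\<^sup>p\<close> norms by a multiple of \<open>n powr (-\<beta> / p)\<close>.
\<close>

section \<open>Essential bounds, interpolation and summation of L^p norms\<close>

lemma Linf_AE_bounded:
  assumes "f \<in> Linf M"
  obtains K where "0 < K" "AE x in M. \<bar>f x\<bar> \<le> K"
proof -
  let ?N = "Linf_norm M f"
  have fin: "?N < \<top>" using assms by (simp add: Linf_def)
  have "AE x in M. ennreal \<bar>f x\<bar> \<le> ?N" unfolding Linf_norm_def by (rule esssup_AE)
  \<comment> \<open>Adding 1 keeps the bound strictly positive even if \<open>f\<close> vanishes
    almost everywhere.\<close>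
  then have "AE x in M. \<bar>f x\<bar> \<le> enn2real ?N + 1"
  proof eventually_elim
    case (elim x)
    with fin have "\<bar>f x\<bar> \<le> enn2real ?N"
      by (metis abs_ge_zero enn2real_ennreal enn2real_mono)
    then show ?case by simp
  qed
  then show ?thesis by (intro that[of "enn2real ?N + 1"]) (auto intro: add_nonneg_pos)
qed

lemma Linf_norm_le:
  assumes "f \<in> borel_measurable M" "AE x in M. \<bar>f x\<bar> \<le> c"
  shows "Linf_norm M f \<le> ennreal c"
proof -
  have "AE x in M. ennreal \<bar>f x\<bar> \<le> ennreal c"
    using assms(2) by eventually_elim (rule ennreal_leI)
  then show ?thesis unfolding Linf_norm_def using assms(1) by (intro esssup_I) auto
qed

text \<open>Off a null set, |f|^p is at most K^(p-1) |f|. Integrating costs only this constant, and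
  the p-th root turns an L^1 bound \<open>A\<close> into an L^p bound of order A^(1/p).\<close>

lemma Lp_norm_interpolation:
  assumes "1 \<le> p" "0 \<le> K" "0 \<le> A"
    and f [measurable]: "f \<in> borel_measurable M"
    and bdd: "AE x in M. \<bar>f x\<bar> \<le> K"
    and int: "(\<integral>\<^sup>+x. ennreal \<bar>f x\<bar> \<partial>M) \<le> ennreal A"
  shows "Lp_norm M p f \<le> ennreal ((K powr (p - 1) * A) powr (1 / p))"
proof -
  let ?I = "\<integral>\<^sup>+x. ennreal (\<bar>f x\<bar> powr p) \<partial>M"
  have "AE x in M. ennreal (\<bar>f x\<bar> powr p) \<le> ennreal (K powr (p - 1)) * ennreal \<bar>f x\<bar>"
    using bdd
  proof eventually_elim
    case (elim x)
    \<comment> \<open>Since \<open>0 powr a = 0\<close> for every \<open>a\<close>, the zeros of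
      \<open>f\<close> cause no trouble even for \<open>p = 1\<close>.\<close>
    have "\<bar>f x\<bar> powr p = \<bar>f x\<bar> powr (p - 1) * \<bar>f x\<bar>"
      by (cases "f x = 0") (simp_all add: powr_diff)
    also have "\<dots> \<le> K powr (p - 1) * \<bar>f x\<bar>"
      using elim \<open>1 \<le> p\<close> by (intro mult_right_mono powr_mono2) auto
    finally show ?case by (simp add: ennreal_leI flip: ennreal_mult)
  qed
  then have "?I \<le> (\<integral>\<^sup>+x. ennreal (K powr (p - 1)) * ennreal \<bar>f x\<bar> \<partial>M)"
    by (rule nn_integral_mono_AE)
  also have "\<dots> = ennreal (K powr (p - 1)) * (\<integral>\<^sup>+x. ennreal \<bar>f x\<bar> \<partial>M)"
    by (rule nn_integral_cmult) simp
  also have "\<dots> \<le> ennreal (K powr (p - 1)) * ennreal A"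
    using int by (rule mult_left_mono) simp
  also have "\<dots> = ennreal (K powr (p - 1) * A)"
    using assms by (simp add: ennreal_mult)
  finally have le: "?I \<le> ennreal (K powr (p - 1) * A)" .
  \<comment> \<open>Finiteness selects the real-valued branch of \<open>Lp_norm\<close>.\<close>
  then have "?I \<noteq> \<infinity>" by (auto simp: top_unique)
  moreover have "enn2real ?I \<le> K powr (p - 1) * A"
    using le assms by (intro enn2real_leI) auto
  ultimately show ?thesis
    using \<open>1 \<le> p\<close> by (auto simp: Lp_norm_def Let_def intro!: ennreal_leI powr_mono2)
qed

text \<open>Interpolation makes the summand of order N^-(s + \<beta>/p) with
  \<open>N = Suc n\<close>, so \<open>exponent\<close> is the convergence condition for this power
  series of reals. The weight exponent \<open>s\<close> is kept free to cover the plain series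
  (\<open>s = 0\<close>) and the weighted ones (\<open>s = 1 / 2\<close>) at once. The index is
  shifted: \<open>f n\<close> is the term belonging to \<open>Suc n\<close>.\<close>

lemma suminf_powr_Lp_norm_finite:
  fixes f :: "nat \<Rightarrow> 'a \<Rightarrow> real"
  assumes "1 \<le> p" "0 \<le> K" "0 \<le> C" and exponent: "s + \<beta> / p > 1"
    and "\<And>n. f n \<in> borel_measurable M"
    and "\<And>n. AE x in M. \<bar>f n x\<bar> \<le> K"
    and "\<And>n. (\<integral>\<^sup>+x. ennreal \<bar>f n x\<bar> \<partial>M) \<le> ennreal (C * real (Suc n) powr - \<beta>)"
  shows "(\<Sum>n. ennreal (real (Suc n) powr - s) * Lp_norm M p (f n)) < \<infinity>"
proof -
  define B where "B = (K powr (p - 1) * C) powr (1 / p)"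
  have "ennreal (real (Suc n) powr - s) * Lp_norm M p (f n)
      \<le> ennreal (B * real (Suc n) powr - (s + \<beta> / p))" for n
  proof -
    have "Lp_norm M p (f n)
        \<le> ennreal ((K powr (p - 1) * (C * real (Suc n) powr - \<beta>)) powr (1 / p))"
      using assms by (intro Lp_norm_interpolation) auto
    also have "(K powr (p - 1) * (C * real (Suc n) powr - \<beta>)) powr (1 / p)
        = B * real (Suc n) powr (- (\<beta> / p))"
      using assms by (simp add: B_def powr_mult powr_powr mult.assoc)
    finally have "ennreal (real (Suc n) powr - s) * Lp_norm M p (f n)
        \<le> ennreal (real (Suc n) powr - s) * ennreal (B * real (Suc n) powr (- (\<beta> / p)))"
      by (rule mult_left_mono) simp
    also have "\<dots> = ennreal (B * (real (Suc n) powr - s * real (Suc n) powr (- (\<beta> / p))))"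
      by (simp add: B_def ac_simps flip: ennreal_mult)
    also have "real (Suc n) powr - s * real (Suc n) powr (- (\<beta> / p))
        = real (Suc n) powr - (s + \<beta> / p)"
      by (simp flip: powr_add)
    finally show ?thesis .
  qed
  then have "(\<Sum>n. ennreal (real (Suc n) powr - s) * Lp_norm M p (f n))
      \<le> (\<Sum>n. ennreal (B * real (Suc n) powr - (s + \<beta> / p)))"
    by (intro suminf_le) auto
  also have "\<dots> < \<top>"
  proof -
    have "summable (\<lambda>n. real n powr - (s + \<beta> / p))"
      using exponent by (subst summable_real_powr_iff) auto
    then have "summable (\<lambda>n. B * real (Suc n) powr - (s + \<beta> / p))"
      by (intro summable_mult) (subst summable_Suc_iff)
    then show ?thesis
      unfolding less_top[symmetric] by (intro ennreal_suminf_neq_top) (auto simp: B_def)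
  qed
  finally show ?thesis by simp
qed

lemma suminf_ennreal_less_top_Suc:
  fixes f :: "nat \<Rightarrow> ennreal"
  assumes "f 0 < \<top>" "(\<Sum>n. f (Suc n)) < \<top>"
  shows "(\<Sum>n. f n) < \<top>"
  using assms suminf_offset[of f 1] by simp

section \<open>Iterates and inverse of a measure-preserving map\<close>

lemma distr_funpow:
  assumes [measurable]: "T \<in> M \<rightarrow>\<^sub>M M" and "distr M M T = M"
  shows "distr M M (T ^^ n) = M"
proof (induction n)
  case 0
  then show ?case by (simp add: id_def)
next
  case (Suc n)
  have "distr M M (T ^^ Suc n) = distr (distr M M (T ^^ n)) M T"
    by (subst distr_distr) simp_all
  with Suc assms(2) show ?case by (simp add: comp_def)
qed

lemma AE_distr_invariant:
  assumes "T \<in> M \<rightarrow>\<^sub>M M" "distr M M T = M" "AE x in M. P x"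
  shows "AE x in M. P (T x)"
  using AE_distrD[OF assms(1), of P] unfolding assms(2) using assms(3) .

lemma invertible_measure_preservingD:
  assumes "invertible_measure_preserving M T"
  shows "T \<in> M \<rightarrow>\<^sub>M M" "distr M M T = M"
    "the_inv_into (space M) T \<in> M \<rightarrow>\<^sub>M M" "distr M M (the_inv_into (space M) T) = M"
    "\<And>x. x \<in> space M \<Longrightarrow> (the_inv_into (space M) T ^^ n) ((T ^^ n) x) = x"
proof -
  let ?S = "the_inv_into (space M) T"
  have bij: "bij_betw T (space M) (space M)" and T [measurable]: "T \<in> M \<rightarrow>\<^sub>M M"
    and S [measurable]: "?S \<in> M \<rightarrow>\<^sub>M M"
    and pres: "\<And>A. A \<in> sets M \<Longrightarrow> emeasure M (T -` A \<inter> space M) = emeasure M A"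
    using assms by (auto simp: invertible_measure_preserving_def)
  show "T \<in> M \<rightarrow>\<^sub>M M" "?S \<in> M \<rightarrow>\<^sub>M M" by fact+
  show dT: "distr M M T = M"
    by (rule measure_eqI) (auto simp: emeasure_distr pres)
  have ST: "?S (T x) = x" if "x \<in> space M" for x
    using bij that by (simp add: bij_betw_def the_inv_into_f_f)
  \<comment> \<open>The inverse inherits invariance: first push \<open>M\<close> forward by
    \<open>T\<close>, which changes nothing, then by \<open>?S\<close>; the composite is the
    identity on \<open>space M\<close>.\<close>
  have "distr M M ?S = distr (distr M M T) M ?S" by (simp add: dT)
  also have "\<dots> = distr M M (\<lambda>x. x)"
    by (subst distr_distr[OF S T]) (rule distr_cong; simp add: ST)
  also have "\<dots> = M" by simp
  finally show "distr M M ?S = M" .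
  show "(?S ^^ n) ((T ^^ n) x) = x" if "x \<in> space M" for x
  proof (induction n)
    case (Suc n)
    \<comment> \<open>The innermost \<open>?S\<close> cancels the outermost \<open>T\<close>, which
      is legitimate only at points of \<open>space M\<close>.\<close>
    have "(T ^^ n) x \<in> space M" using measurable_space[OF measurable_compose_n[OF T] that] .
    with Suc show ?case unfolding funpow_Suc_right[of n ?S] by (simp add: ST)
  qed simp
qed

section \<open>Leaves and functions constant on them\<close>

lemma leaf_in_partition:
  assumes "partition_on A W" "x \<in> A"
  shows "leaf W x \<in> W" "x \<in> leaf W x"
proof -
  have "\<exists>!w. w \<in> W \<and> x \<in> w"
    using assms by (fastforce simp: partition_on_def disjoint_def)
  from theI'[OF this] show "leaf W x \<in> W" "x \<in> leaf W x" by (auto simp: leaf_def)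
qed

lemma leaf_eq:
  assumes "partition_on A W" "w \<in> W" "x \<in> w"
  shows "leaf W x = w"
  unfolding leaf_def using assms by (intro the_equality) (auto simp: partition_on_def disjoint_def)

text \<open>A preimage under a function constant on leaves contains every leaf that it meets, so it
  is a union of leaves; measurability in \<open>M\<close> then puts it into the leaf algebra. This
  is how leafwise suprema and infima become admissible bounds for the conditional
  expectation.\<close>

lemma borel_measurable_leaf_algebra:
  fixes f :: "'a \<Rightarrow> 'b::topological_space"
  assumes W: "partition_on (space M) W" and f: "f \<in> borel_measurable M"
    and const: "\<And>x y. x \<in> space M \<Longrightarrow> y \<in> leaf W x \<Longrightarrow> f y = f x"
  shows "f \<in> borel_measurable (leaf_algebra M W)"
proof (rule measurableI)
  fix A :: "'b set" assume "A \<in> sets borel"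
  let ?P = "f -` A \<inter> space M"
  have sub: "w \<subseteq> space M" if "w \<in> W" for w
    using that partition_onD1[OF W] by blast
  have "?P = \<Union>{w \<in> W. w \<inter> ?P \<noteq> {}}"
  proof (intro equalityI subsetI)
    fix x assume "x \<in> ?P"
    with leaf_in_partition[OF W, of x] show "x \<in> \<Union>{w \<in> W. w \<inter> ?P \<noteq> {}}" by blast
  next
    fix x assume "x \<in> \<Union>{w \<in> W. w \<inter> ?P \<noteq> {}}"
    then obtain w y where w: "w \<in> W" "x \<in> w" "y \<in> w" "f y \<in> A" "y \<in> space M" by blast
    with const[of y x] leaf_eq[OF W, of w y] sub show "x \<in> ?P" by auto
  qed
  moreover have "?P \<in> sets M" using f \<open>A \<in> sets borel\<close> by (rule measurable_sets)
  ultimately show "f -` A \<inter> space (leaf_algebra M W) \<in> sets (leaf_algebra M W)"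
    by (auto simp: sets_leaf_algebra[OF W] intro!: exI[of _ "{w \<in> W. w \<inter> ?P \<noteq> {}}"])
qed simp

section \<open>Conditional expectations: essential bound, leafwise enclosure, duality\<close>

lemma (in prob_space) AE_abs_real_cond_exp_le:
  assumes "subalgebra M F" "integrable M f" "AE x in M. \<bar>f x\<bar> \<le> K"
  shows "AE x in M. \<bar>real_cond_exp M F f x\<bar> \<le> K"
proof -
  interpret finite_measure_subalgebra M F by unfold_locales fact
  have "AE x in M. real_cond_exp M F f x \<le> K"
    using assms by (intro real_cond_exp_le_c) auto
  moreover have "AE x in M. - K \<le> real_cond_exp M F f x"
    using assms by (intro real_cond_exp_ge_c) auto
  ultimately show ?thesis by eventually_elim auto
qed

lemma (in finite_measure) integrable_AE_bounded:
  fixes f :: "'a \<Rightarrow> real"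
  assumes "f \<in> borel_measurable M" "AE x in M. \<bar>f x\<bar> \<le> K"
  shows "integrable M f"
  using assms by (intro integrable_const_bound) auto

text \<open>Only a finite diameter \<open>d\<close> needs an argument: then each
  \<open>f y - d\<close> is a lower bound of all values, so the infimum is real and the supremum
  exceeds it by at most \<open>d\<close>. Extended reals are used because \<open>f\<close> may be
  unbounded on \<open>A\<close>.\<close>

lemma e2ennreal_SUP_diff_INF_le_ediam:
  fixes f :: "'a \<Rightarrow> real"
  assumes "A \<noteq> {}"
  shows "e2ennreal ((SUP y\<in>A. ereal (f y)) - (INF y\<in>A. ereal (f y))) \<le> ediam (f ` A)"
proof (cases "ediam (f ` A)")
  case (real d)
  have dist: "f y \<le> f z + d" if "y \<in> A" "z \<in> A" for y z
  proof -
    have "ennreal (dist (f y) (f z)) \<le> ediam (f ` A)"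
      unfolding ediam_def using that by (intro SUP_upper2[of "f y"] SUP_upper2[of "f z"]) auto
    then show ?thesis using real by (auto simp: dist_real_def)
  qed
  let ?S = "SUP y\<in>A. ereal (f y)" and ?I = "INF y\<in>A. ereal (f y)"
  obtain a where "a \<in> A" using assms by blast
  have le: "ereal (f y - d) \<le> ?I" if "y \<in> A" for y
    using dist[OF that] by (intro INF_greatest) (simp add: algebra_simps)
  moreover have "?I \<le> ereal (f a)" using \<open>a \<in> A\<close> by (rule INF_lower)
  ultimately obtain i where i: "?I = ereal i" using le[OF \<open>a \<in> A\<close>] by (cases ?I) auto
  have "?S \<le> ereal (i + d)"
    using le i by (intro SUP_least) (simp add: algebra_simps)
  then have "?S - ?I \<le> ereal d"
    using i by (simp add: ereal_minus_le_iff add.commute)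
  then have "e2ennreal (?S - ?I) \<le> e2ennreal (ereal d)" by (rule e2ennreal_mono)
  then show ?thesis using real by simp
qed simp

lemma (in prob_space) AE_real_cond_exp_diff_le_ediam:
  fixes f :: "'a \<Rightarrow> real"
  assumes W: "partition_on (space M) W" and meas: "leafwise_measurable M W f"
    and f: "integrable M f"
    and fin: "(\<integral>\<^sup>+x. ediam (f ` leaf W x) \<partial>M) < \<infinity>"
  shows "AE x in M. ennreal \<bar>real_cond_exp M (leaf_algebra M W) f x - f x\<bar> \<le> ediam (f ` leaf W x)"
proof -
  let ?F = "leaf_algebra M W"
  interpret finite_measure_subalgebra M ?F
    by unfold_locales (rule subalgebra_leaf_algebra[OF W])
  define S where "S x = (SUP y\<in>leaf W x. ereal (f y))" for x
  define I where "I x = (INF y\<in>leaf W x. ereal (f y))" for x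
  \<comment> \<open>\<open>real_of_ereal\<close> sends infinite values to 0; this will affect only a
    null set.\<close>
  define s where "s x = real_of_ereal (S x)" for x
  define i where "i x = real_of_ereal (I x)" for x
  have [measurable]: "S \<in> borel_measurable M" "I \<in> borel_measurable M"
    using meas by (auto simp: leafwise_measurable_def S_def[abs_def] I_def[abs_def])
  have [measurable]: "f \<in> borel_measurable M" using f by simp
  have [measurable]: "s \<in> borel_measurable M" "i \<in> borel_measurable M"
    by (auto simp: s_def[abs_def] i_def[abs_def])
  have same: "leaf W y = leaf W x" if "x \<in> space M" "y \<in> leaf W x" for x y
    using leaf_eq[OF W leaf_in_partition(1)[OF W that(1)] that(2)] .
  have sF: "s \<in> borel_measurable ?F" and iF: "i \<in> borel_measurable ?F"
    by (rule borel_measurable_leaf_algebra[OF W]; simp add: s_def i_def S_def I_def same)+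
  have gap: "e2ennreal (S x - I x) \<le> ediam (f ` leaf W x)" if "x \<in> space M" for x
    unfolding S_def I_def using leaf_in_partition(2)[OF W that]
    by (intro e2ennreal_SUP_diff_INF_le_ediam) auto
  \<comment> \<open>The gap \<open>S - I\<close> is measurable by
    \<open>leafwise_measurable\<close>, so a finite integral makes it finite almost everywhere.
    Measurability of \<open>ediam\<close> along leaves need not be established.\<close>
  have "(\<integral>\<^sup>+x. e2ennreal (S x - I x) \<partial>M) \<le> (\<integral>\<^sup>+x. ediam (f ` leaf W x) \<partial>M)"
    by (rule nn_integral_mono) (rule gap)
  with fin have int: "(\<integral>\<^sup>+x. e2ennreal (S x - I x) \<partial>M) < \<infinity>" by simp
  then have "AE x in M. e2ennreal (S x - I x) \<noteq> \<infinity>"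
    by (intro nn_integral_noteq_infinite) auto
  then have real: "AE x in M. S x = ereal (s x) \<and> I x = ereal (i x) \<and> i x \<le> f x \<and> f x \<le> s x"
    using AE_space
  proof eventually_elim
    case (elim x)
    have "I x \<le> ereal (f x)" "ereal (f x) \<le> S x"
      unfolding S_def I_def using leaf_in_partition(2)[OF W elim(2)]
      by (auto intro: INF_lower SUP_upper)
    \<comment> \<open>The real number \<open>f x\<close> lies between \<open>I x\<close> and
      \<open>S x\<close>, so a finite gap excludes infinite values of either.\<close>
    with elim(1) show ?case
      by (cases "S x"; cases "I x") (auto simp: s_def i_def)
  qed
  have "(\<integral>\<^sup>+x. ennreal (norm (s x - i x)) \<partial>M) \<le> (\<integral>\<^sup>+x. e2ennreal (S x - I x) \<partial>M)"
    by (rule nn_integral_mono_AE, use real in eventually_elim) auto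
  then have gap_int: "integrable M (\<lambda>x. s x - i x)"
    using int by (auto intro!: integrableI_bounded)
  \<comment> \<open>Because i \<le> f \<le> s almost everywhere, this function dominates both |s|
    and |i|, neither of which is known to be bounded.\<close>
  have bound: "integrable M (\<lambda>x. \<bar>f x\<bar> + (s x - i x))"
    using f gap_int by auto
  have s: "integrable M s" and i: "integrable M i"
    by (rule Bochner_Integration.integrable_bound[OF bound], simp, use real in eventually_elim, force)+
  have "AE x in M. real_cond_exp M ?F f x \<le> real_cond_exp M ?F s x"
    using real f s by (intro real_cond_exp_mono) auto
  moreover have "AE x in M. real_cond_exp M ?F i x \<le> real_cond_exp M ?F f x"
    using real f i by (intro real_cond_exp_mono) auto
  ultimately show ?thesis
    using real real_cond_exp_F_meas[OF s sF] real_cond_exp_F_meas[OF i iF] AE_space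
  proof eventually_elim
    case (elim x)
    \<comment> \<open>As \<open>s\<close> and \<open>i\<close> are their own conditional
      expectations, monotonicity places both \<open>f x\<close> and its conditional expectation in
      the interval from \<open>i x\<close> to \<open>s x\<close>.\<close>
    then have "ennreal \<bar>real_cond_exp M ?F f x - f x\<bar> \<le> e2ennreal (S x - I x)"
      by (auto intro!: ennreal_leI)
    also have "\<dots> \<le> ediam (f ` leaf W x)" using elim by (intro gap) simp
    finally show ?case .
  qed
qed

text \<open>Testing against the sign of the conditional expectation computes its L^1 norm exactly.
  \<open>S\<close> and \<open>T\<close> are a general pair so that n-th iterates can be inserted for
  them, with the decay rate as \<open>D\<close>.\<close>

lemma (in prob_space) nn_integral_real_cond_exp_inverse_le:
  fixes \<phi> :: "'a \<Rightarrow> real"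
  assumes "subalgebra M F"
    and T [measurable]: "T \<in> M \<rightarrow>\<^sub>M M" and inv: "distr M M T = M"
    and S [measurable]: "S \<in> M \<rightarrow>\<^sub>M M" and ST: "\<And>x. x \<in> space M \<Longrightarrow> S (T x) = x"
    and f: "integrable M (\<lambda>x. \<phi> (S x))" and \<phi> [measurable]: "\<phi> \<in> borel_measurable M"
    and dual: "\<And>\<psi>. \<psi> \<in> Linf M \<Longrightarrow> \<psi> \<in> borel_measurable F \<Longrightarrow>
      ennreal \<bar>\<integral>x. \<phi> x * \<psi> (T x) \<partial>M\<bar> \<le> ennreal D * Linf_norm M \<psi>"
  shows "(\<integral>\<^sup>+x. ennreal \<bar>real_cond_exp M F (\<lambda>y. \<phi> (S y)) x\<bar> \<partial>M) \<le> ennreal D"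
proof -
  interpret finite_measure_subalgebra M F by unfold_locales fact
  let ?g = "real_cond_exp M F (\<lambda>y. \<phi> (S y))"
  \<comment> \<open>The sign is measurable for \<open>F\<close> and bounded by 1, hence an
    admissible test function in \<open>dual\<close>.\<close>
  define \<psi> where "\<psi> x = sgn (?g x)" for x
  have \<psi>F [measurable]: "\<psi> \<in> borel_measurable F" unfolding \<psi>_def by measurable
  have \<psi>M [measurable]: "\<psi> \<in> borel_measurable M" by (rule measurable_from_subalg[OF subalg \<psi>F])
  have bdd: "\<bar>\<psi> x\<bar> \<le> 1" for x by (simp add: \<psi>_def sgn_real_def)
  have norm: "Linf_norm M \<psi> \<le> ennreal 1" by (rule Linf_norm_le) (use bdd in auto)
  then have Linf: "\<psi> \<in> Linf M" by (auto simp: Linf_def intro: le_less_trans)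
  have prod: "integrable M (\<lambda>x. \<psi> x * \<phi> (S x))"
    by (rule Bochner_Integration.integrable_bound[OF f])
      (use bdd in \<open>auto simp: abs_mult intro!: mult_left_le_one_le\<close>)
  have int: "integrable M ?g" using f by (rule real_cond_exp_int(1))
  have "(\<integral>\<^sup>+x. ennreal \<bar>?g x\<bar> \<partial>M) = ennreal (\<integral>x. \<bar>?g x\<bar> \<partial>M)"
    using int by (intro nn_integral_eq_integral) auto
  also have "(\<integral>x. \<bar>?g x\<bar> \<partial>M) = (\<integral>x. \<psi> x * ?g x \<partial>M)"
    by (simp add: \<psi>_def abs_sgn mult.commute)
  also have "\<dots> = (\<integral>x. \<psi> x * \<phi> (S x) \<partial>M)"
    by (rule real_cond_exp_intg(2)[OF prod]) measurable
  \<comment> \<open>Replacing x by \<open>T x\<close> cancels \<open>S\<close> inside \<phi> and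
    moves \<open>T\<close> onto \<psi>.\<close>
  also have "\<dots> = (\<integral>x. \<psi> x * \<phi> (S x) \<partial>distr M M T)" by (simp only: inv)
  also have "\<dots> = (\<integral>x. \<phi> x * \<psi> (T x) \<partial>M)"
    by (subst integral_distr) (auto simp: ST mult.commute intro!: Bochner_Integration.integral_cong)
  also have "ennreal (\<integral>x. \<phi> x * \<psi> (T x) \<partial>M) \<le> ennreal \<bar>\<integral>x. \<phi> x * \<psi> (T x) \<partial>M\<bar>"
    by (simp add: ennreal_leI)
  also have "\<dots> \<le> ennreal D * Linf_norm M \<psi>" by (rule dual[OF Linf \<psi>F])
  also have "\<dots> \<le> ennreal D" using mult_left_mono[OF norm, of "ennreal D"] by simp
  finally show ?thesis .
qed

section \<open>Decay of the two families and convergence of the four series\<close>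

theorem theorem3p1:
  fixes M :: "'a measure" and T :: "'a \<Rightarrow> 'a" and W :: "'a set set"
    and \<phi> :: "'a \<Rightarrow> real" and \<beta> C :: real
  assumes "prob_space M"
    and "invertible_measure_preserving M T"
    and "ergodic M T"
    and "partition_on (space M) W" and "W \<subseteq> sets M"
    and "\<And>x. x \<in> space M \<Longrightarrow> T ` leaf W x \<subseteq> leaf W (T x)"
    and "\<phi> \<in> Linf M" and "(\<integral>x. \<phi> x \<partial>M) = 0"
    and "\<beta> > 1" and "C > 0"
    and a: "\<And>n \<psi>. n \<ge> 1 \<Longrightarrow> \<psi> \<in> Linf M \<Longrightarrow> \<psi> \<in> borel_measurable (leaf_algebra M W) \<Longrightarrow>
           ennreal \<bar>\<integral>x. \<phi> x * \<psi> ((T ^^ n) x) \<partial>M\<bar>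
             \<le> ennreal C * Linf_norm M \<psi> * ennreal (real n powr - \<beta>)"
    and b_meas: "\<And>n. n \<ge> 1 \<Longrightarrow> leafwise_measurable M W (\<lambda>x. \<phi> ((T ^^ n) x))"
    and b: "\<And>n. n \<ge> 1 \<Longrightarrow>
           (\<integral>\<^sup>+x. ediam (\<phi> ` (T ^^ n) ` leaf W x) \<partial>M) \<le> ennreal (C * real n powr - \<beta>)"
  shows "(\<forall>p::real. 1 \<le> p \<and> p < \<beta> \<longrightarrow>
      (\<Sum>n. Lp_norm M p (real_cond_exp M (leaf_algebra M W)
               (\<lambda>y. \<phi> ((the_inv_into (space M) T ^^ Suc n) y)))) < \<infinity> \<and>
      (\<Sum>n. Lp_norm M p (\<lambda>x. real_cond_exp M (leaf_algebra M W) (\<lambda>y. \<phi> ((T ^^ n) y)) x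
                            - \<phi> ((T ^^ n) x))) < \<infinity>) \<and>
    (\<forall>p::real. 1 \<le> p \<and> p < 2 * \<beta> \<longrightarrow>
      (\<Sum>n. ennreal (real (Suc n) powr (- 1 / 2)) *
         Lp_norm M p (real_cond_exp M (leaf_algebra M W)
               (\<lambda>y. \<phi> ((the_inv_into (space M) T ^^ Suc n) y)))) < \<infinity> \<and>
      (\<Sum>n. ennreal (real (Suc n) powr (- 1 / 2)) *
         Lp_norm M p (\<lambda>x. real_cond_exp M (leaf_algebra M W) (\<lambda>y. \<phi> ((T ^^ Suc n) y)) x
                            - \<phi> ((T ^^ Suc n) x))) < \<infinity>)"
proof -
  interpret prob_space M by fact
  let ?F = "leaf_algebra M W" and ?S = "the_inv_into (space M) T"
  have sub: "subalgebra M ?F" by (rule subalgebra_leaf_algebra) fact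
  interpret finite_measure_subalgebra M ?F by unfold_locales (rule sub)
  note T = invertible_measure_preservingD[OF \<open>invertible_measure_preserving M T\<close>]
  note [measurable] = T(1,3)
  have [measurable]: "\<phi> \<in> borel_measurable M" using \<open>\<phi> \<in> Linf M\<close> by (simp add: Linf_def)
  obtain K where K: "0 < K" "AE x in M. \<bar>\<phi> x\<bar> \<le> K"
    using Linf_AE_bounded[OF \<open>\<phi> \<in> Linf M\<close>] .
  \<comment> \<open>\<phi> is bounded only off a null set; invariance keeps the preimages of that
    set null.\<close>
  have bddT: "AE x in M. \<bar>\<phi> ((T ^^ n) x)\<bar> \<le> K" for n
    by (rule AE_distr_invariant[OF _ _ K(2)]) (use T in \<open>simp_all add: distr_funpow\<close>)
  have bddS: "AE x in M. \<bar>\<phi> ((?S ^^ n) x)\<bar> \<le> K" for n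
    by (rule AE_distr_invariant[OF _ _ K(2)]) (use T in \<open>simp_all add: distr_funpow\<close>)
  have intT: "integrable M (\<lambda>x. \<phi> ((T ^^ n) x))" for n
    by (rule integrable_AE_bounded[OF _ bddT]) measurable
  have intS: "integrable M (\<lambda>x. \<phi> ((?S ^^ n) x))" for n
    by (rule integrable_AE_bounded[OF _ bddS]) measurable

  define g where "g n = real_cond_exp M ?F (\<lambda>y. \<phi> ((?S ^^ n) y))" for n
  define h where "h n x = real_cond_exp M ?F (\<lambda>y. \<phi> ((T ^^ n) y)) x - \<phi> ((T ^^ n) x)" for n x
  have [measurable]: "g n \<in> borel_measurable M" "h n \<in> borel_measurable M" for n
    by (auto simp: g_def h_def[abs_def])
  have g_bdd: "AE x in M. \<bar>g n x\<bar> \<le> K" for n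
    unfolding g_def by (rule AE_abs_real_cond_exp_le[OF sub intS bddS])
  \<comment> \<open>One \<open>K\<close> for the conditional expectation and one for the function
    itself.\<close>
  have h_bdd: "AE x in M. \<bar>h n x\<bar> \<le> 2 * K" for n
    using AE_abs_real_cond_exp_le[OF sub intT bddT, of n] bddT[of n]
    by eventually_elim (auto simp: h_def)
  have g_int: "(\<integral>\<^sup>+x. ennreal \<bar>g (Suc n) x\<bar> \<partial>M) \<le> ennreal (C * real (Suc n) powr - \<beta>)" for n
    unfolding g_def
  proof (rule nn_integral_real_cond_exp_inverse_le[where T = "T ^^ Suc n"])
    fix \<psi> assume \<psi>: "\<psi> \<in> Linf M" "\<psi> \<in> borel_measurable ?F"
    have "ennreal \<bar>\<integral>x. \<phi> x * \<psi> ((T ^^ Suc n) x) \<partial>M\<bar>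
        \<le> ennreal C * Linf_norm M \<psi> * ennreal (real (Suc n) powr - \<beta>)"
      using \<psi> by (intro a) auto
    also have "\<dots> = ennreal (C * real (Suc n) powr - \<beta>) * Linf_norm M \<psi>"
      using \<open>C > 0\<close> by (simp add: ennreal_mult ac_simps)
    finally show "ennreal \<bar>\<integral>x. \<phi> x * \<psi> ((T ^^ Suc n) x) \<partial>M\<bar>
        \<le> ennreal (C * real (Suc n) powr - \<beta>) * Linf_norm M \<psi>" .
  qed (use T intS sub distr_funpow[OF T(1,2), of "Suc n"] in \<open>auto simp del: funpow.simps\<close>)
  have h_int: "(\<integral>\<^sup>+x. ennreal \<bar>h (Suc n) x\<bar> \<partial>M) \<le> ennreal (C * real (Suc n) powr - \<beta>)" for n
  proof -
    have diam: "(\<integral>\<^sup>+x. ediam ((\<lambda>x. \<phi> ((T ^^ Suc n) x)) ` leaf W x) \<partial>M)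
        \<le> ennreal (C * real (Suc n) powr - \<beta>)"
      using b[of "Suc n"] by (simp add: image_image del: funpow.simps)
    then have fin: "(\<integral>\<^sup>+x. ediam ((\<lambda>x. \<phi> ((T ^^ Suc n) x)) ` leaf W x) \<partial>M) < \<infinity>"
      by (rule le_less_trans) simp
    have meas: "leafwise_measurable M W (\<lambda>x. \<phi> ((T ^^ Suc n) x))" by (rule b_meas) simp
    have "(\<integral>\<^sup>+x. ennreal \<bar>h (Suc n) x\<bar> \<partial>M)
        \<le> (\<integral>\<^sup>+x. ediam ((\<lambda>x. \<phi> ((T ^^ Suc n) x)) ` leaf W x) \<partial>M)"
      unfolding h_def
      by (rule nn_integral_mono_AE,
          rule AE_real_cond_exp_diff_le_ediam[OF \<open>partition_on (space M) W\<close> meas intT fin])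
    with diam show ?thesis by (rule order_trans[rotated])
  qed
  have g_sum: "(\<Sum>n. ennreal (real (Suc n) powr - s) * Lp_norm M p (g (Suc n))) < \<infinity>"
    if "1 \<le> p" "s + \<beta> / p > 1" for p s
    using that K(1) \<open>C > 0\<close> g_bdd g_int by (intro suminf_powr_Lp_norm_finite[of p K C]) auto
  have h_sum: "(\<Sum>n. ennreal (real (Suc n) powr - s) * Lp_norm M p (h (Suc n))) < \<infinity>"
    if "1 \<le> p" "s + \<beta> / p > 1" for p s
    using that K(1) \<open>C > 0\<close> h_bdd h_int by (intro suminf_powr_Lp_norm_finite[of p "2 * K" C]) auto
  \<comment> \<open>The unweighted series of \<open>h\<close> starts at index 0, where (b) says
    nothing; on a probability space the essential bound alone gives a finite norm.\<close>
  have h_0: "Lp_norm M p (h 0) < \<top>" if "1 \<le> p" for p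
  proof -
    have "(\<integral>\<^sup>+x. ennreal \<bar>h 0 x\<bar> \<partial>M) \<le> (\<integral>\<^sup>+x. ennreal (2 * K) \<partial>M)"
      by (rule nn_integral_mono_AE, use h_bdd[of 0] in eventually_elim) (rule ennreal_leI)
    then have "(\<integral>\<^sup>+x. ennreal \<bar>h 0 x\<bar> \<partial>M) \<le> ennreal (2 * K)" by (simp add: emeasure_space_1)
    then have "Lp_norm M p (h 0) \<le> ennreal (((2 * K) powr (p - 1) * (2 * K)) powr (1 / p))"
      using that K(1) h_bdd by (intro Lp_norm_interpolation) auto
    then show ?thesis by (rule le_less_trans) simp
  qed
  have "(\<Sum>n. Lp_norm M p (g (Suc n))) < \<infinity> \<and> (\<Sum>n. Lp_norm M p (h n)) < \<infinity>"
    if "1 \<le> p" "p < \<beta>" for p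
  proof -
    \<comment> \<open>Weight exponent \<open>s = 0\<close>: the convergence condition is exactly p <
      \<beta>.\<close>
    have "0 + \<beta> / p > 1" using that by (simp add: field_simps)
    from g_sum[OF that(1) this] h_sum[OF that(1) this] h_0[OF that(1)] show ?thesis
      by (auto intro: suminf_ennreal_less_top_Suc)
  qed
  moreover have "(\<Sum>n. ennreal (real (Suc n) powr (- 1 / 2)) * Lp_norm M p (g (Suc n))) < \<infinity> \<and>
      (\<Sum>n. ennreal (real (Suc n) powr (- 1 / 2)) * Lp_norm M p (h (Suc n))) < \<infinity>"
    if "1 \<le> p" "p < 2 * \<beta>" for p
  proof -
    \<comment> \<open>Weight exponent \<open>s = 1 / 2\<close>: the factor n^(-1/2) relaxes the
      condition to p < 2\<beta>.\<close>
    have "1 / 2 + \<beta> / p > 1" using that by (simp add: field_simps)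
    from g_sum[OF that(1) this] h_sum[OF that(1) this] show ?thesis by simp
  qed
  ultimately show ?thesis unfolding g_def h_def by blast
qed

end
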